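(* Let $n\ge 1$. For an element $c=\sum_{\sigma\in\mathfrak{S}_n}c_\sigma\,\sigma$ of the group ring $\mathbb{C}[\mathfrak{S}_n]$, put $$P_c(z_1,\ldots,z_n,w_1,\ldots,w_n)=\sum_{\sigma\in\mathfrak{S}_n}c_\sigma\prod_{j=1}^n(z_{\sigma(j)}-w_j).$$ Then the set of all $c\in\mathbb{C}[\mathfrak{S}_n]$ for which $P_c$ is Grace-like is a multiplicative sub-semigroup of $\mathbb{C}[\mathfrak{S}_n]$; that is, if $c,d\in\mathbb{C}[\mathfrak{S}_n]$ are such that $P_c$ and $P_d$ are Grace-like, then $P_{cd}$ is Grace-like, where $cd$ is the product in the group ring.
   Context: $\mathfrak{S}_n$ is the symmetric group on $\{1,\ldots,n\}$, with product $(\sigma\tau)(i)=\sigma(\tau(i))$. A polynomial is multiaffine if each variable occurs in it at most to the first power. A multiaffine complex polynomial $P(z_1,\ldots,z_n,w_1,\ldots,w_n)$ is Grace-like if $P(z_1,\ldots,z_n,w_1,\ldots,w_n)\neq 0$ for all complex numbers such that $z_1,\ldots,z_n$ are separated from $w_1,\ldots,w_n$ by a circle of the Riemann sphere, i.e. there is a circle or straight line in $\mathbb{C}$ such that all the $z_i$ lie in one of the two connected components of its complement in $\mathbb{C}$ and all the $w_j$ lie in the other component. *)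

theory Defs
  imports "HOL-Analysis.Analysis" "HOL-Algebra.Sym_Groups"
begin

(* An element of the group ring is its coefficient function, taken to be 0 off the group. *)
definition group_ring :: "nat \<Rightarrow> ((nat \<Rightarrow> nat) \<Rightarrow> complex) set" where
  "group_ring n = {c. \<forall>\<sigma>. \<sigma> \<notin> carrier (sym_group n) \<longrightarrow> c \<sigma> = 0}"

definition group_ring_mult ::
  "nat \<Rightarrow> ((nat \<Rightarrow> nat) \<Rightarrow> complex) \<Rightarrow> ((nat \<Rightarrow> nat) \<Rightarrow> complex) \<Rightarrow> (nat \<Rightarrow> nat) \<Rightarrow> complex" where
  "group_ring_mult n c d = (\<lambda>\<rho>.
     \<Sum>(\<sigma>, \<tau>) \<in> {(\<sigma>, \<tau>). \<sigma> \<in> carrier (sym_group n) \<and> \<tau> \<in> carrier (sym_group n) \<and>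
       \<sigma> \<otimes>\<^bsub>sym_group n\<^esub> \<tau> = \<rho>}. c \<sigma> * d \<tau>)"

(* Polynomials in z_1,...,z_n,w_1,...,w_n are represented by the polynomial functions they
   induce, which determine them over the complex numbers.  Of the arguments z and w only the
   values at 1,...,n matter. *)
definition perm_poly ::
  "nat \<Rightarrow> ((nat \<Rightarrow> nat) \<Rightarrow> complex) \<Rightarrow> (nat \<Rightarrow> complex) \<Rightarrow> (nat \<Rightarrow> complex) \<Rightarrow> complex" where
  "perm_poly n c z w = (\<Sum>\<sigma> \<in> carrier (sym_group n). c \<sigma> * (\<Prod>j = 1..n. z (\<sigma> j) - w j))"

definition multiaffine :: "nat \<Rightarrow> ((nat \<Rightarrow> complex) \<Rightarrow> (nat \<Rightarrow> complex) \<Rightarrow> complex) \<Rightarrow> bool" where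
  "multiaffine n P \<longleftrightarrow> (\<exists>a. \<forall>z w.
     P z w = (\<Sum>A \<in> Pow {1..n}. \<Sum>B \<in> Pow {1..n}. a A B * (\<Prod>i\<in>A. z i) * (\<Prod>j\<in>B. w j)))"

definition circle_or_line :: "complex set \<Rightarrow> bool" where
  "circle_or_line K \<longleftrightarrow>
     (\<exists>a r. r > 0 \<and> K = sphere a r) \<or> (\<exists>a b. a \<noteq> b \<and> K = affine hull {a, b})"

definition separated :: "nat \<Rightarrow> (nat \<Rightarrow> complex) \<Rightarrow> (nat \<Rightarrow> complex) \<Rightarrow> bool" where
  "separated n z w \<longleftrightarrow>
     (\<exists>K U V. circle_or_line K \<and> U \<in> components (- K) \<and> V \<in> components (- K) \<and> U \<noteq> V \<and>
       (\<forall>i\<in>{1..n}. z i \<in> U) \<and> (\<forall>j\<in>{1..n}. w j \<in> V))"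

definition grace_like :: "nat \<Rightarrow> ((nat \<Rightarrow> complex) \<Rightarrow> (nat \<Rightarrow> complex) \<Rightarrow> complex) \<Rightarrow> bool" where
  "grace_like n P \<longleftrightarrow> multiaffine n P \<and> (\<forall>z w. separated n z w \<longrightarrow> P z w \<noteq> 0)"

end

theory Submission imports Defs begin

text \<open>
  Writing the product of the group ring as a double sum gives
  \<open>P_cd(z, w) = \<Sum>\<sigma>. \<Sum>\<tau>. c(\<sigma>) d(\<tau>\<^sup>-\<^sup>1) \<Prod>k. (z(\<sigma> k) - w(\<tau> k))\<close>, in which each factor \<open>z(\<sigma> k) - w(\<tau> k)\<close> arises
  from \<open>(z(\<sigma> k) s(k) - 1) (v(k) - w(\<tau> k))\<close> by an Asano contraction: take the coefficient of
  \<open>s(k) v(k)\<close> minus the constant coefficient. Before any contraction the sum is \<open>P_c\<close>, with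
  second argument \<open>1 / s\<close>, times \<open>P_d\<close>, with first argument \<open>v\<close>. If a circle of radius r about
  the origin separates z (inside) from w (outside), neither factor vanishes for \<open>|s(k)| \<le> 1 / r\<close>
  and \<open>|v(k)| \<le> r\<close>, and contractions preserve this.
\<close>

section \<open>Separation by circles and lines\<close>

text \<open>A connected set that contains one of the open sets and meets the other would be
  disconnected by the pair; hence both are maximal.\<close>

lemma components_of_two_open:
  fixes A B :: "'a::topological_space set"
  assumes "X = A \<union> B" "open A" "open B" "connected A" "connected B" "A \<noteq> {}" "B \<noteq> {}" "A \<inter> B = {}"
  shows "components X = {A, B}"
proof -
  have *: "C \<in> components (C \<union> D)"
    if "open C" "open D" "connected C" "C \<noteq> {}" "C \<inter> D = {}" for C D :: "'a set"
    unfolding in_components_maximal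
  proof (intro conjI allI impI)
    fix E assume E: "E \<noteq> {} \<and> C \<subseteq> E \<and> E \<subseteq> C \<union> D \<and> connected E"
    then have "C \<inter> E = {} \<or> D \<inter> E = {}"
      using connectedD[of E C D] that by blast
    then show "E = C" using E that by blast
  qed (use that in auto)
  have A: "A \<in> components X" and B: "B \<in> components X"
    using *[of A B] *[of B A] assms by (auto simp: Un_commute Int_commute)
  have "U = A \<or> U = B" if U: "U \<in> components X" for U
  proof -
    have "U \<noteq> {}" "U \<subseteq> A \<union> B"
      using U in_components_nonempty in_components_subset assms(1) by blast+
    then have "U \<inter> A \<noteq> {} \<or> U \<inter> B \<noteq> {}" by blast
    then show ?thesis using components_eq U A B by blast
  qed
  then show ?thesis using A B by blast
qed

lemma components_Compl_sphere:
  fixes a :: complex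
  assumes "r > 0"
  shows "components (- sphere a r) = {ball a r, - cball a r}"
proof (rule components_of_two_open)
  show "- sphere a r = ball a r \<union> - cball a r" by auto
  show "connected (- cball a r)"
    by (intro connected_complement_bounded_convex) auto
  have "dist a (a + of_real (r + 1)) = \<bar>r + 1\<bar>"
    unfolding dist_norm by (metis add_diff_cancel_left' norm_minus_commute norm_of_real)
  then have "a + of_real (r + 1) \<in> - cball a r" using assms by simp
  then show "- cball a r \<noteq> {}" by blast
  show "ball a r \<noteq> {}" using assms by simp
qed (use ball_subset_cball in auto)

text \<open>The affine map \<open>x \<mapsto> (x - a) / (b - a)\<close> sends \<open>a\<close> to 0
  and \<open>b\<close> to 1, hence the line to the real axis and its sides to the two
  half-planes.\<close>

lemma components_Compl_line:
  fixes a b :: complex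
  assumes "a \<noteq> b"
  shows "components (- (affine hull {a, b})) =
    {{x. Im ((x - a) / (b - a)) > 0}, {x. Im ((x - a) / (b - a)) < 0}}"
proof (rule components_of_two_open)
  have "x \<in> affine hull {a, b} \<longleftrightarrow> Im ((x - a) / (b - a)) = 0" for x
  proof
    assume "x \<in> affine hull {a, b}"
    then obtain u v where uv: "u + v = 1" "x = u *\<^sub>R a + v *\<^sub>R b"
      by (auto simp: affine_hull_2)
    then have u: "u = 1 - v" by simp
    then have "x - a = of_real v * (b - a)"
      unfolding uv(2) u by (simp add: scaleR_conv_of_real algebra_simps)
    then show "Im ((x - a) / (b - a)) = 0" using assms by simp
  next
    assume *: "Im ((x - a) / (b - a)) = 0"
    define v where "v = Re ((x - a) / (b - a))"
    have "(x - a) / (b - a) = of_real v" using * by (simp add: complex_eq_iff v_def)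
    then have "x = (1 - v) *\<^sub>R a + v *\<^sub>R b"
      using assms by (simp add: scaleR_conv_of_real field_simps)
    then show "x \<in> affine hull {a, b}" unfolding affine_hull_2 by force
  qed
  then show "- (affine hull {a, b}) =
      {x. Im ((x - a) / (b - a)) > 0} \<union> {x. Im ((x - a) / (b - a)) < 0}"
    by force
  \<comment> \<open>Each side is the image of a half-plane under the inverse affine map, which
    transfers connectedness and nonemptiness.\<close>
  have image: "{x. P ((x - a) / (b - a))} = (\<lambda>y. a + (b - a) * y) ` {y. P y}" for P
  proof (intro equalityI subsetI)
    fix x assume "x \<in> {x. P ((x - a) / (b - a))}"
    then show "x \<in> (\<lambda>y. a + (b - a) * y) ` {y. P y}"
      using assms by (intro image_eqI[of _ _ "(x - a) / (b - a)"]) auto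
  qed (use assms in auto)
  show "connected {x. Im ((x - a) / (b - a)) > 0}" "connected {x. Im ((x - a) / (b - a)) < 0}"
    unfolding image[of "\<lambda>y. Im y > 0"] image[of "\<lambda>y. Im y < 0"]
    by (intro connected_continuous_image continuous_intros convex_connected
        convex_halfspace_Im_gt convex_halfspace_Im_lt)+
  have "\<i> \<in> {y. Im y > 0}" "- \<i> \<in> {y. Im y < 0}" by simp_all
  then show "{x. Im ((x - a) / (b - a)) > 0} \<noteq> {}" "{x. Im ((x - a) / (b - a)) < 0} \<noteq> {}"
    unfolding image[of "\<lambda>y. Im y > 0"] image[of "\<lambda>y. Im y < 0"] by blast+
  show "open {x. Im ((x - a) / (b - a)) > 0}" "open {x. Im ((x - a) / (b - a)) < 0}"
    using assms by (intro open_Collect_less continuous_intros; simp)+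
qed auto

lemma separated_commute: "separated n z w \<longleftrightarrow> separated n w z"
  unfolding separated_def by blast

lemma separated_by_circle:
  assumes "r > 0" "\<And>i. i \<in> {1..n} \<Longrightarrow> dist a (z i) < r" "\<And>j. j \<in> {1..n} \<Longrightarrow> r < dist a (w j)"
  shows "separated n z w"
  unfolding separated_def
proof (intro exI conjI)
  show "circle_or_line (sphere a r)" using assms(1) by (auto simp: circle_or_line_def)
  show "ball a r \<in> components (- sphere a r)" "- cball a r \<in> components (- sphere a r)"
    by (simp_all add: components_Compl_sphere[OF assms(1)])
  have "a \<in> ball a r" "a \<notin> - cball a r" using assms(1) by auto
  then show "ball a r \<noteq> - cball a r" by blast
qed (use assms in \<open>auto simp: not_le\<close>)

lemma separated_by_vertical_line:
  assumes "\<And>i. i \<in> {1..n} \<Longrightarrow> Re (z i) < t" "\<And>j. j \<in> {1..n} \<Longrightarrow> t < Re (w j)"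
  shows "separated n z w"
  unfolding separated_def
proof (intro exI conjI)
  \<comment> \<open>Here \<open>?b - ?a\<close> is \<open>- \<i>\<close>, and division by it turns
    the real part of \<open>x - ?a\<close> into an imaginary part.\<close>
  let ?a = "complex_of_real t" and ?b = "complex_of_real t - \<i>"
  have Im: "Im ((x - ?a) / (?b - ?a)) = Re x - t" for x
    by (simp add: Im_divide)
  have ne: "?a \<noteq> ?b" by (simp add: complex_eq_iff)
  show "circle_or_line (affine hull {?a, ?b})" using ne unfolding circle_or_line_def by blast
  show "{x. Re x < t} \<in> components (- (affine hull {?a, ?b}))"
    "{x. Re x > t} \<in> components (- (affine hull {?a, ?b}))"
    unfolding components_Compl_line[OF ne] Im by auto
  have "complex_of_real (t - 1) \<in> {x. Re x < t}" "complex_of_real (t - 1) \<notin> {x. Re x > t}" by auto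
  then show "{x. Re x < t} \<noteq> {x. Re x > t}" by blast
qed (use assms in auto)

text \<open>The separating circle is tangent to the line at \<open>a\<close>, with a large radius.\<close>
lemma separated_by_line_imp_circle:
  fixes z w :: "'i \<Rightarrow> complex"
  assumes "finite I" "a \<noteq> b"
    and z: "\<And>i. i \<in> I \<Longrightarrow> Im ((z i - a) / (b - a)) > 0"
    and w: "\<And>i. i \<in> I \<Longrightarrow> Im ((w i - a) / (b - a)) < 0"
  obtains c r where "r > 0" "\<And>i. i \<in> I \<Longrightarrow> dist c (z i) < r" "\<And>i. i \<in> I \<Longrightarrow> r < dist c (w i)"
proof -
  define Z W where "Z i = (z i - a) / (b - a)" and "W i = (w i - a) / (b - a)" for i
  \<comment> \<open>In the coordinates \<open>Z\<close>, \<open>W\<close> the line is the real axis.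
    A point \<open>x\<close> lies in the open disc of centre \<open>\<i> R\<close> and radius
    \<open>R\<close> iff its squared modulus is below \<open>2 R Im x\<close>; as \<open>I\<close>
    is finite, one large \<open>R\<close> serves every \<open>Z i\<close>.\<close>
  have "\<forall>\<^sub>F R in at_top. \<forall>i\<in>I. (cmod (Z i))\<^sup>2 / (2 * Im (Z i)) < R"
    using assms(1) by (intro eventually_ball_finite ballI eventually_gt_at_top)
  then have "\<forall>\<^sub>F R in at_top. (\<forall>i\<in>I. (cmod (Z i))\<^sup>2 / (2 * Im (Z i)) < R) \<and> R > 0"
    using eventually_gt_at_top[of "0::real"] by eventually_elim auto
  then obtain R where R: "R > 0" "\<And>i. i \<in> I \<Longrightarrow> (cmod (Z i))\<^sup>2 / (2 * Im (Z i)) < R"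
    unfolding eventually_at_top_linorder by blast
  have norm: "(cmod (x - \<i> * of_real R))\<^sup>2 = (cmod x)\<^sup>2 - 2 * R * Im x + R\<^sup>2" for x
    unfolding cmod_power2 by (simp add: power2_eq_square algebra_simps)
  define c where "c = a + (b - a) * (\<i> * of_real R)"
  have dist: "dist c x = cmod (b - a) * cmod ((x - a) / (b - a) - \<i> * of_real R)" for x
  proof -
    have "(b - a) * ((x - a) / (b - a) - \<i> * of_real R) = (x - a) - (b - a) * (\<i> * of_real R)"
      using assms(2) unfolding right_diff_distrib[of "b - a" "(x - a) / (b - a)"] by simp
    then have "x - c = (b - a) * ((x - a) / (b - a) - \<i> * of_real R)"
      by (simp add: c_def)
    then show ?thesis by (metis dist_commute dist_norm norm_mult)
  qed
  have pos: "cmod (b - a) > 0" using assms(2) by simp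
  show thesis
  proof
    show "cmod (b - a) * R > 0" using pos R(1) by simp
    fix i assume i: "i \<in> I"
    have "(cmod (Z i))\<^sup>2 < 2 * R * Im (Z i)"
      using R(2)[OF i] z[OF i] by (simp add: Z_def[symmetric] field_simps)
    then have "(cmod (Z i - \<i> * of_real R))\<^sup>2 < R\<^sup>2" by (simp add: norm)
    then have "cmod (Z i - \<i> * of_real R) < R"
      using R(1) power2_less_imp_less by fastforce
    then show "dist c (z i) < cmod (b - a) * R" using pos by (simp add: dist Z_def)
    \<comment> \<open>Points of the lower half-plane lie outside this disc for every positive
      \<open>R\<close>.\<close>
    have "R * Im (W i) < 0" using R(1) w[OF i] by (simp add: W_def mult_pos_neg)
    then have "R\<^sup>2 < (cmod (W i - \<i> * of_real R))\<^sup>2"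
      unfolding norm using zero_le_power2[of "cmod (W i)"] by linarith
    then have "R < cmod (W i - \<i> * of_real R)"
      using power2_less_imp_less by fastforce
    then show "cmod (b - a) * R < dist c (w i)" using pos by (simp add: dist W_def)
  qed
qed

text \<open>Only finitely many points are involved, so a separating line can be replaced by a
  circle. The disjunction records which family is inside.\<close>

lemma separated_imp_circle:
  assumes "separated n z w"
  obtains a r where "r > 0"
    "(\<forall>i\<in>{1..n}. dist a (z i) < r \<and> r < dist a (w i)) \<or>
     (\<forall>i\<in>{1..n}. dist a (w i) < r \<and> r < dist a (z i))"
proof -
  obtain K U V where K: "circle_or_line K" and UV: "U \<in> components (- K)" "V \<in> components (- K)" "U \<noteq> V"
    and z: "\<And>i. i \<in> {1..n} \<Longrightarrow> z i \<in> U" and w: "\<And>i. i \<in> {1..n} \<Longrightarrow> w i \<in> V"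
    using assms unfolding separated_def by blast
  from K consider a r where "r > 0" "K = sphere a r" | a b where "a \<noteq> b" "K = affine hull {a, b}"
    unfolding circle_or_line_def by blast
  then show thesis
  proof cases
    case 1
    then have "U = ball a r \<and> V = - cball a r \<or> V = ball a r \<and> U = - cball a r"
      using UV by (auto simp: components_Compl_sphere)
    then show thesis using z w 1(1) by (intro that[of r a]) (auto simp: not_le)
  next
    case 2
    let ?L = "{x. Im ((x - a) / (b - a)) > 0}" and ?R = "{x. Im ((x - a) / (b - a)) < 0}"
    have "components (- K) = {?L, ?R}" 
      unfolding 2(2) by (rule components_Compl_line[OF 2(1)])
    then have "U = ?L \<and> V = ?R \<or> V = ?L \<and> U = ?R" using UV by blast
    then show thesis
    proof (elim disjE conjE)
      assume "U = ?L" "V = ?R"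
      then show thesis
        using separated_by_line_imp_circle[of "{1..n}" a b z w] 2 z w that
        by (smt (verit) finite_atLeastAtMost mem_Collect_eq)
    next
      assume "V = ?L" "U = ?R"
      then show thesis
        using separated_by_line_imp_circle[of "{1..n}" a b w z] 2 z w that
        by (smt (verit) finite_atLeastAtMost mem_Collect_eq)
    qed
  qed
qed

section \<open>Asano contraction\<close>

text \<open>On the diagonal \<open>s = t / r\<close>, \<open>v = r t\<close> the polynomial is quadratic in \<open>t\<close> with both roots
  outside the unit disc, and \<open>\<alpha> / \<delta>\<close> is the product of the roots.\<close>
lemma asano_contraction:
  fixes \<alpha> \<beta> \<gamma> \<delta> :: complex
  assumes r: "r > 0"
    and nz: "\<And>s v. cmod s \<le> 1 / r \<Longrightarrow> cmod v \<le> r \<Longrightarrow> \<alpha> + \<beta> * s + \<gamma> * v + \<delta> * s * v \<noteq> 0"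
  shows "cmod \<delta> < cmod \<alpha>"
proof (rule ccontr)
  assume "\<not> cmod \<delta> < cmod \<alpha>"
  then have le: "cmod \<alpha> \<le> cmod \<delta>" by simp
  have \<alpha>: "\<alpha> \<noteq> 0" using nz[of 0 0] r by simp
  \<comment> \<open>Under the negated claim the quadratic has degree exactly two, so it has the two
    roots \<open>t1\<close>, \<open>t2\<close>, possibly equal.\<close>
  then have \<delta>: "\<delta> \<noteq> 0" using le by auto
  define B where "B = \<beta> / r + \<gamma> * r"
  define q where "q = csqrt (B\<^sup>2 - 4 * \<alpha> * \<delta>)"
  define t1 t2 where "t1 = (- B + q) / (2 * \<delta>)" and "t2 = (- B - q) / (2 * \<delta>)"
  have q: "q\<^sup>2 = B\<^sup>2 - 4 * \<alpha> * \<delta>" by (simp add: q_def)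
  have big: "cmod t > 1" if "\<alpha> + B * t + \<delta> * t\<^sup>2 = 0" for t
  proof (rule ccontr)
    assume "\<not> cmod t > 1"
    then have "cmod (t / r) \<le> 1 / r" "cmod (r * t) \<le> r"
      using r by (auto simp: norm_divide norm_mult field_simps)
    from nz[OF this] show False
      using that r by (simp add: B_def field_simps power2_eq_square)
  qed
  have "4 * \<delta> * (\<alpha> + B * t1 + \<delta> * t1\<^sup>2) = 4 * \<alpha> * \<delta> + q\<^sup>2 - B\<^sup>2"
    "4 * \<delta> * (\<alpha> + B * t2 + \<delta> * t2\<^sup>2) = 4 * \<alpha> * \<delta> + q\<^sup>2 - B\<^sup>2"
    using \<delta> by (simp_all add: t1_def t2_def field_simps power2_eq_square)
  then have "cmod t1 > 1" "cmod t2 > 1"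
    using \<delta> by (auto intro!: big simp: q)
  then have "cmod (t1 * t2) > 1" by (simp add: norm_mult less_1_mult)
  moreover have "t1 * t2 = \<alpha> / \<delta>"
  proof -
    have "t1 * t2 = (B\<^sup>2 - q\<^sup>2) / (4 * \<delta>\<^sup>2)"
      by (simp add: t1_def t2_def power2_eq_square algebra_simps)
    also have "\<dots> = \<alpha> / \<delta>" using \<delta> unfolding q by (simp add: power2_eq_square)
    finally show ?thesis .
  qed
  ultimately show False using le \<delta> by (simp add: norm_divide field_simps)
qed

text \<open>The pairs \<open>(s k, v k)\<close> are contracted one at a time. Contracting at
  \<open>m\<close> multiplies \<open>C i\<close> by \<open>x i m - y i m\<close>, so the induction
  must leave \<open>C\<close> arbitrary.\<close>

lemma multi_contraction:
  fixes C :: "'i \<Rightarrow> complex" and x y :: "'i \<Rightarrow> 'k \<Rightarrow> complex"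
  assumes r: "r > 0" and "finite S"
    and nz: "\<And>s v. (\<And>k. cmod (s k) \<le> 1 / r) \<Longrightarrow> (\<And>k. cmod (v k) \<le> r) \<Longrightarrow>
      (\<Sum>i\<in>I. C i * (\<Prod>k\<in>S. (x i k * s k - 1) * (v k - y i k))) \<noteq> 0"
  shows "(\<Sum>i\<in>I. C i * (\<Prod>k\<in>S. x i k - y i k)) \<noteq> 0"
  using assms(2) nz
proof (induction S arbitrary: C rule: finite_induct)
  case empty
  from empty(1)[of "\<lambda>_. 0" "\<lambda>_. 0"] r show ?case by simp
next
  case (insert m S)
  have "(\<Sum>i\<in>I. (C i * (x i m - y i m)) * (\<Prod>k\<in>S. x i k - y i k)) \<noteq> 0"
  proof (rule insert.IH)
    fix s v :: "'k \<Rightarrow> complex"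
    assume s: "\<And>k. cmod (s k) \<le> 1 / r" and v: "\<And>k. cmod (v k) \<le> r"
    \<comment> \<open>With the other variables frozen in \<open>A\<close>, the sum is affine in each
      of \<open>s'\<close> and \<open>v'\<close>. Its constant coefficient carries
      \<open>y i m\<close> and its \<open>s' v'\<close> coefficient \<open>x i m\<close>; their
      moduli differ, so their difference is nonzero.\<close>
    define A where "A i = C i * (\<Prod>k\<in>S. (x i k * s k - 1) * (v k - y i k))" for i
    have "cmod (\<Sum>i\<in>I. A i * x i m) < cmod (\<Sum>i\<in>I. A i * y i m)"
    proof (rule asano_contraction[OF r])
      fix s' v' assume *: "cmod s' \<le> 1 / r" "cmod v' \<le> r"
      have "(\<Sum>i\<in>I. C i * (\<Prod>k\<in>insert m S. (x i k * (s(m := s')) k - 1) * ((v(m := v')) k - y i k))) \<noteq> 0"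
        by (rule insert.prems) (use s v * in auto)
      also have "(\<Sum>i\<in>I. C i * (\<Prod>k\<in>insert m S. (x i k * (s(m := s')) k - 1) * ((v(m := v')) k - y i k)))
        = (\<Sum>i\<in>I. A i * ((x i m * s' - 1) * (v' - y i m)))"
      proof (rule sum.cong[OF refl])
        fix i assume "i \<in> I"
        have "(\<Prod>k\<in>S. (x i k * (s(m := s')) k - 1) * ((v(m := v')) k - y i k)) =
          (\<Prod>k\<in>S. (x i k * s k - 1) * (v k - y i k))"
          using insert.hyps by (intro prod.cong) auto
        then show "C i * (\<Prod>k\<in>insert m S. (x i k * (s(m := s')) k - 1) * ((v(m := v')) k - y i k)) =
          A i * ((x i m * s' - 1) * (v' - y i m))"
          using insert.hyps by (simp add: A_def)
      qed
      also have "\<dots> = (\<Sum>i\<in>I. A i * y i m) + (- (\<Sum>i\<in>I. A i * (x i m * y i m))) * s' +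
          (- (\<Sum>i\<in>I. A i)) * v' + (\<Sum>i\<in>I. A i * x i m) * s' * v'"
        by (simp add: sum_distrib_right sum_distrib_left sum.distrib[symmetric]
            sum_subtractf[symmetric] sum_negf[symmetric] algebra_simps)
      finally show "(\<Sum>i\<in>I. A i * y i m) + (- (\<Sum>i\<in>I. A i * (x i m * y i m))) * s' +
          (- (\<Sum>i\<in>I. A i)) * v' + (\<Sum>i\<in>I. A i * x i m) * s' * v' \<noteq> 0" .
    qed
    then have "(\<Sum>i\<in>I. A i * x i m) - (\<Sum>i\<in>I. A i * y i m) \<noteq> 0" by auto
    also have "(\<Sum>i\<in>I. A i * x i m) - (\<Sum>i\<in>I. A i * y i m) =
      (\<Sum>i\<in>I. C i * (x i m - y i m) * (\<Prod>k\<in>S. (x i k * s k - 1) * (v k - y i k)))"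
      by (simp add: A_def sum_subtractf[symmetric] algebra_simps)
    finally show "(\<Sum>i\<in>I. C i * (x i m - y i m) * (\<Prod>k\<in>S. (x i k * s k - 1) * (v k - y i k))) \<noteq> 0" .
  qed
  then show ?case using insert.hyps by (simp add: mult.assoc)
qed

section \<open>Permutation polynomials\<close>

text \<open>The analytic half of \<open>grace_like\<close>, kept apart because
  \<open>perm_poly\<close> is multiaffine for every coefficient function.\<close>

definition nonvanishing :: "nat \<Rightarrow> ((nat \<Rightarrow> nat) \<Rightarrow> complex) \<Rightarrow> bool" where
  "nonvanishing n c \<longleftrightarrow> (\<forall>z w. separated n z w \<longrightarrow> perm_poly n c z w \<noteq> 0)"

lemma carrier_sym_group: "carrier (sym_group n) = {\<sigma>. \<sigma> permutes {1..n}}"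
  by (simp add: sym_group_def)

lemma prod_diff_swap:
  fixes f g :: "'a \<Rightarrow> 'b::comm_ring_1"
  shows "(\<Prod>k\<in>A. f k - g k) = (- 1) ^ card A * (\<Prod>k\<in>A. g k - f k)"
proof -
  have "(\<Prod>k\<in>A. f k - g k) = (\<Prod>k\<in>A. - 1 * (g k - f k))" by simp
  then show ?thesis unfolding prod.distrib by simp
qed

text \<open>Reindexing each product by \<sigma> exchanges \<open>z\<close> and \<open>w\<close> up
  to the sign \<open>(- 1) ^ n\<close>, and separation is symmetric.\<close>

lemma nonvanishing_inv:
  assumes "nonvanishing n c"
  shows "nonvanishing n (\<lambda>\<sigma>. c (inv' \<sigma>))"
proof -
  have "perm_poly n (\<lambda>\<sigma>. c (inv' \<sigma>)) z w = (- 1) ^ n * perm_poly n c w z" for z w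
  proof -
    have "perm_poly n (\<lambda>\<sigma>. c (inv' \<sigma>)) z w =
      (\<Sum>\<sigma> | \<sigma> permutes {1..n}. c (inv' \<sigma>) * (\<Prod>j = 1..n. z (\<sigma> j) - w j))"
      by (simp add: perm_poly_def carrier_sym_group)
    also have "\<dots> = (\<Sum>\<sigma> | \<sigma> permutes {1..n}. c (inv' (inv' \<sigma>)) * (\<Prod>j = 1..n. z (inv' \<sigma> j) - w j))"
      by (rule sum_permutations_inverse)
    also have "\<dots> = (\<Sum>\<sigma> | \<sigma> permutes {1..n}. c \<sigma> * (\<Prod>j = 1..n. (- 1) * (w (\<sigma> j) - z j)))"
    proof (rule sum.cong[OF refl])
      fix \<sigma> assume "\<sigma> \<in> {\<sigma>. \<sigma> permutes {1..n}}"
      then have \<sigma>: "\<sigma> permutes {1..n}" by simp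
      have "(\<Prod>j = 1..n. z (inv' \<sigma> j) - w j) = (\<Prod>j = 1..n. z (inv' \<sigma> (\<sigma> j)) - w (\<sigma> j))"
        using prod.permute[OF \<sigma>, of "\<lambda>j. z (inv' \<sigma> j) - w j"] by (simp add: o_def)
      then show "c (inv' (inv' \<sigma>)) * (\<Prod>j = 1..n. z (inv' \<sigma> j) - w j) =
          c \<sigma> * (\<Prod>j = 1..n. (- 1) * (w (\<sigma> j) - z j))"
        using \<sigma> by (simp add: permutes_inv_inv permutes_inverses)
    qed
    also have "\<dots> = (- 1) ^ n * perm_poly n c w z"
      unfolding prod.distrib perm_poly_def carrier_sym_group sum_distrib_left
      by (simp add: mult_ac)
    finally show ?thesis .
  qed
  then show ?thesis using assms unfolding nonvanishing_def
    by (metis separated_commute mult_eq_0_iff power_eq_0_iff neg_equal_0_iff_equal zero_neq_one)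
qed

text \<open>Substituting \<open>s = 1 / u\<close> and clearing denominators, this is nonvanishing for \<open>u\<close> outside
  the circle of radius \<open>p\<close>, including \<open>u = \<infinity>\<close>. The Moebius map \<open>u \<mapsto> 1 / (u - p)\<close> sends the
  circle to a line and infinity to 0, so that no limit argument is needed.\<close>
lemma nonvanishing_at_infinity:
  assumes c: "nonvanishing n c" and p: "p > 0"
    and z: "\<And>i. i \<in> {1..n} \<Longrightarrow> cmod (z i) < p" and s: "\<And>k. cmod (s k) < 1 / p"
  shows "(\<Sum>\<sigma> | \<sigma> permutes {1..n}. c \<sigma> * (\<Prod>k = 1..n. z (\<sigma> k) * s k - 1)) \<noteq> 0"
proof -
  let ?p = "complex_of_real p"
  \<comment> \<open>\<open>U k\<close> is the image of \<open>u = 1 / s k\<close> under the same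
    Moebius map, written so that \<open>s k = 0\<close> gives the image 0 of infinity.\<close>
  define Z where "Z i = 1 / (z i - ?p)" for i
  define U where "U k = s k / (1 - ?p * s k)" for k
  have zp: "z i - ?p \<noteq> 0" if "i \<in> {1..n}" for i
    using z[OF that] p by auto
  have ps: "cmod (?p * s k) < 1" for k
    using s[of k] p by (simp add: norm_mult field_simps)
  then have sp: "1 - ?p * s k \<noteq> 0" for k by (metis eq_iff_diff_eq_0 norm_one less_irrefl)
  have "separated n Z U"
  proof (rule separated_by_vertical_line)
    fix i assume i: "i \<in> {1..n}"
    have "(cmod (z i))\<^sup>2 < p\<^sup>2" using z[OF i] by (simp add: power_strict_mono)
    then have "(Re (z i))\<^sup>2 + (Im (z i))\<^sup>2 < p\<^sup>2" by (simp add: cmod_power2)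
    moreover have "(Re (z i) - p)\<^sup>2 + (Im (z i))\<^sup>2 > 0"
      using zp[OF i] by (simp add: complex_eq_iff sum_power2_gt_zero_iff)
    \<comment> \<open>The circle passes through the pole \<open>p\<close>, and \<open>- p\<close> is
      sent to \<open>- 1 / (2 * p)\<close>; the image is the vertical line through that point, with
      the disc going to its left.\<close>
    ultimately show "Re (Z i) < - 1 / (2 * p)"
      using p by (simp add: Z_def Re_divide field_simps power2_eq_square)
  next
    fix k
    define q where "q = ?p * s k"
    have "(cmod q)\<^sup>2 < 1" using ps[of k] by (simp add: q_def abs_square_less_1)
    then have *: "(Re q)\<^sup>2 + (Im q)\<^sup>2 < 1" by (simp add: cmod_power2)
    have **: "(1 - Re q)\<^sup>2 + (Im q)\<^sup>2 > 0"
      using sp[of k] by (auto simp: q_def[symmetric] complex_eq_iff sum_power2_gt_zero_iff)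
    have "Re (q / (1 - q)) = (Re q * (1 - Re q) - (Im q)\<^sup>2) / ((1 - Re q)\<^sup>2 + (Im q)\<^sup>2)"
      by (simp add: Re_divide power2_eq_square)
    also have "\<dots> > - 1 / 2" using * ** by (simp add: field_simps power2_eq_square)
    finally have "- 1 / 2 < Re (q / (1 - q))" .
    moreover have "q / (1 - q) = of_real p * U k" by (simp add: U_def q_def)
    ultimately have "- 1 / 2 < p * Re (U k)" by simp
    then show "- 1 / (2 * p) < Re (U k)" using p by (simp add: field_simps)
  qed
  then have nz: "perm_poly n c Z U \<noteq> 0" using c by (simp add: nonvanishing_def)
  \<comment> \<open>The cleared denominators. Permuting the factors \<open>z k - ?p\<close> does not
    change their product, so \<open>D\<close> is common to all \<sigma>.\<close>
  define D where "D = (\<Prod>k = 1..n. z k - ?p) * (\<Prod>k = 1..n. 1 - ?p * s k)"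
  have "(\<Sum>\<sigma> | \<sigma> permutes {1..n}. c \<sigma> * (\<Prod>k = 1..n. z (\<sigma> k) * s k - 1)) =
    (- 1) ^ n * D * perm_poly n c Z U"
    unfolding perm_poly_def carrier_sym_group sum_distrib_left
  proof (rule sum.cong[OF refl])
    fix \<sigma> assume "\<sigma> \<in> {\<sigma>. \<sigma> permutes {1..n}}"
    then have \<sigma>: "\<sigma> permutes {1..n}" by simp
    have "(\<Prod>k = 1..n. z k - ?p) = (\<Prod>k = 1..n. z (\<sigma> k) - ?p)"
      using prod.permute[OF \<sigma>, of "\<lambda>k. z k - ?p"] by (simp add: o_def)
    moreover have "(- 1) ^ n = (\<Prod>k = 1..n. (- 1 :: complex))" by simp
    ultimately have "(- 1) ^ n * D * (\<Prod>k = 1..n. Z (\<sigma> k) - U k) =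
      (\<Prod>k = 1..n. - 1 * ((z (\<sigma> k) - ?p) * (1 - ?p * s k)) * (Z (\<sigma> k) - U k))"
      unfolding D_def by (simp only: prod.distrib)
    also have "\<dots> = (\<Prod>k = 1..n. z (\<sigma> k) * s k - 1)"
    proof (rule prod.cong[OF refl])
      fix k assume "k \<in> {1..n}"
      then have "z (\<sigma> k) - ?p \<noteq> 0" using zp permutes_in_image[OF \<sigma>] by blast
      then show "- 1 * ((z (\<sigma> k) - ?p) * (1 - ?p * s k)) * (Z (\<sigma> k) - U k) = z (\<sigma> k) * s k - 1"
        using sp[of k] unfolding Z_def U_def
        by (simp add: divide_simps) (simp add: algebra_simps)
    qed
    finally show "c \<sigma> * (\<Prod>k = 1..n. z (\<sigma> k) * s k - 1) =
        (- 1) ^ n * D * (c \<sigma> * (\<Prod>k = 1..n. Z (\<sigma> k) - U k))"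
      by (metis mult.left_commute)
  qed
  moreover have "D \<noteq> 0" using zp sp by (auto simp: D_def)
  ultimately show ?thesis using nz by simp
qed

section \<open>Contracting a product of two permutation polynomials\<close>

text \<open>Radii \<open>p < r < \<rho>\<close> turn the closed bounds \<open>1 / r\<close> on
  \<open>s\<close> and \<open>r\<close> on \<open>v\<close> into the strict ones needed for the
  factors of \<open>c\<close> and \<open>e\<close>.\<close>

lemma contraction_nonzero_disc:
  assumes c: "nonvanishing n c" and e: "nonvanishing n e" and \<rho>: "\<rho> > 0"
    and z: "\<And>i. i \<in> {1..n} \<Longrightarrow> cmod (z i) < \<rho>" and w: "\<And>i. i \<in> {1..n} \<Longrightarrow> \<rho> < cmod (w i)"
  shows "(\<Sum>(\<sigma>, \<tau>) \<in> {\<sigma>. \<sigma> permutes {1..n}} \<times> {\<tau>. \<tau> permutes {1..n}}.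
    c \<sigma> * e \<tau> * (\<Prod>k = 1..n. z (\<sigma> k) - w (\<tau> k))) \<noteq> 0"
proof -
  have "\<exists>p. 0 < p \<and> p < \<rho> \<and> (\<forall>i\<in>{1..n}. cmod (z i) < p)"
  proof -
    \<comment> \<open>Inserting 0 keeps the set nonempty when \<open>n = 0\<close> and makes
      \<open>p\<close> positive.\<close>
    have "Max (insert 0 ((\<lambda>i. cmod (z i)) ` {1..n})) < \<rho>" using z \<rho> by (subst Max_less_iff) auto
    then obtain p where p: "Max (insert 0 ((\<lambda>i. cmod (z i)) ` {1..n})) < p" "p < \<rho>" using dense by blast
    then have "\<forall>x\<in>insert 0 ((\<lambda>i. cmod (z i)) ` {1..n}). x < p"
      by (subst (asm) Max_less_iff) auto
    then show ?thesis using p(2) by auto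
  qed
  then obtain p where p: "0 < p" "p < \<rho>" "\<And>i. i \<in> {1..n} \<Longrightarrow> cmod (z i) < p" by blast
  obtain r where r: "p < r" "r < \<rho>" using dense p(2) by blast
  let ?I = "{\<sigma>. \<sigma> permutes {1..n}} \<times> {\<tau>. \<tau> permutes {1..n}}"
  have "(\<Sum>i\<in>?I. c (fst i) * e (snd i) * (\<Prod>k = 1..n. z (fst i k) - w (snd i k))) \<noteq> 0"
  proof (rule multi_contraction)
    show "r > 0" "finite {1..n}"
      using p r by auto
    fix s v :: "nat \<Rightarrow> complex"
    assume s: "\<And>k. cmod (s k) \<le> 1 / r" and v: "\<And>k. cmod (v k) \<le> r"
    have "1 / r < 1 / p" using p r by (simp add: frac_less2)
    then have *: "(\<Sum>\<sigma> | \<sigma> permutes {1..n}. c \<sigma> * (\<Prod>k = 1..n. z (\<sigma> k) * s k - 1)) \<noteq> 0"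
      using s by (intro nonvanishing_at_infinity[OF c p(1) p(3)]) (auto intro: le_less_trans)
    have "separated n v w"
      using \<rho> v w r by (intro separated_by_circle[of \<rho> n 0]) (auto intro: le_less_trans)
    then have "perm_poly n e w v \<noteq> 0"
      using e by (simp add: nonvanishing_def separated_commute)
    moreover have "(\<Prod>k = 1..n. v k - w (\<tau> k)) = (- 1) ^ n * (\<Prod>k = 1..n. w (\<tau> k) - v k)" for \<tau>
      by (subst prod_diff_swap) simp
    then have "(\<Sum>\<tau> | \<tau> permutes {1..n}. e \<tau> * (\<Prod>k = 1..n. v k - w (\<tau> k))) =
       (- 1) ^ n * perm_poly n e w v"
      by (simp add: perm_poly_def carrier_sym_group sum_distrib_left mult_ac)
    ultimately have "(\<Sum>\<sigma> | \<sigma> permutes {1..n}. c \<sigma> * (\<Prod>k = 1..n. z (\<sigma> k) * s k - 1)) *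
       (\<Sum>\<tau> | \<tau> permutes {1..n}. e \<tau> * (\<Prod>k = 1..n. v k - w (\<tau> k))) \<noteq> 0"
      using * by simp
    \<comment> \<open>Before contraction the variables \<open>s\<close> and \<open>v\<close> are
      independent, so the double sum factors.\<close>
    also have "(\<Sum>\<sigma> | \<sigma> permutes {1..n}. c \<sigma> * (\<Prod>k = 1..n. z (\<sigma> k) * s k - 1)) *
       (\<Sum>\<tau> | \<tau> permutes {1..n}. e \<tau> * (\<Prod>k = 1..n. v k - w (\<tau> k))) =
      (\<Sum>i\<in>?I. c (fst i) * e (snd i) *
        (\<Prod>k = 1..n. (z (fst i k) * s k - 1) * (v k - w (snd i k))))"
      unfolding sum_product sum.cartesian_product prod.distrib split_def by (simp add: mult_ac)
    finally show "(\<Sum>i\<in>?I. c (fst i) * e (snd i) *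
        (\<Prod>k = 1..n. (z (fst i k) * s k - 1) * (v k - w (snd i k)))) \<noteq> 0" .
  qed
  then show ?thesis by (simp add: split_def)
qed

text \<open>Translation moves the centre to 0. If \<open>w\<close> is the inner family, exchanging
  \<open>(c, z)\<close> with \<open>(e, w)\<close> changes the sum only by a sign.\<close>

lemma contraction_nonzero:
  assumes c: "nonvanishing n c" and e: "nonvanishing n e" and "separated n z w"
  shows "(\<Sum>(\<sigma>, \<tau>) \<in> {\<sigma>. \<sigma> permutes {1..n}} \<times> {\<tau>. \<tau> permutes {1..n}}.
    c \<sigma> * e \<tau> * (\<Prod>k = 1..n. z (\<sigma> k) - w (\<tau> k))) \<noteq> 0" (is "?Q c e z w \<noteq> 0")
proof -
  from assms(3) obtain a r where r: "r > 0"
    "(\<forall>i\<in>{1..n}. dist a (z i) < r \<and> r < dist a (w i)) \<or>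
     (\<forall>i\<in>{1..n}. dist a (w i) < r \<and> r < dist a (z i))"
    by (rule separated_imp_circle)
  have nz: "?Q c e z w \<noteq> 0"
    if "nonvanishing n c" "nonvanishing n e" "\<forall>i\<in>{1..n}. dist a (z i) < r \<and> r < dist a (w i)" for c e z w
    using contraction_nonzero_disc[OF that(1,2) r(1), of "\<lambda>i. z i - a" "\<lambda>i. w i - a"] that(3)
    by (simp add: dist_norm norm_minus_commute)
  have swap: "?Q c e z w = (- 1) ^ n * ?Q e c w z"
  proof -
    have prod: "(\<Prod>k = 1..n. z (\<sigma> k) - w (\<tau> k)) = (- 1) ^ n * (\<Prod>k = 1..n. w (\<tau> k) - z (\<sigma> k))" for \<sigma> \<tau>
      by (subst prod_diff_swap) simp
    show ?thesis
      unfolding sum.cartesian_product[symmetric]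
      unfolding prod by (subst sum.swap) (simp add: sum_distrib_left mult_ac)
  qed
  from r(2) show ?thesis
  proof
    assume "\<forall>i\<in>{1..n}. dist a (w i) < r \<and> r < dist a (z i)"
    then have "?Q e c w z \<noteq> 0" using nz c e by blast
    then show ?thesis unfolding swap by simp
  qed (use nz c e in blast)
qed

section \<open>The product in the group ring\<close>

text \<open>Replacing \<tau> by its inverse and putting \<open>j = \<tau> k\<close> in the product
  makes both permutations act on the same index \<open>k\<close>, the form that can be
  contracted.\<close>

lemma perm_poly_mult:
  "perm_poly n (group_ring_mult n c d) z w =
    (\<Sum>(\<sigma>, \<tau>) \<in> {\<sigma>. \<sigma> permutes {1..n}} \<times> {\<tau>. \<tau> permutes {1..n}}.
      c \<sigma> * d (inv' \<tau>) * (\<Prod>k = 1..n. z (\<sigma> k) - w (\<tau> k)))"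
proof -
  let ?S = "{\<sigma>. \<sigma> permutes {1..n}}"
  have fin: "finite ?S" by (simp add: finite_permutations)
  let ?f = "\<lambda>\<rho>. \<Prod>j = 1..n. z (\<rho> j) - w j"
  have "perm_poly n (group_ring_mult n c d) z w =
    (\<Sum>\<rho>\<in>?S. \<Sum>(\<sigma>, \<tau>) \<in> {p \<in> ?S \<times> ?S. fst p \<circ> snd p = \<rho>}. c \<sigma> * d \<tau> * ?f (\<sigma> \<circ> \<tau>))"
    unfolding perm_poly_def carrier_sym_group
  proof (rule sum.cong[OF refl])
    fix \<rho>
    have "{(\<sigma>, \<tau>). \<sigma> \<in> ?S \<and> \<tau> \<in> ?S \<and> \<sigma> \<otimes>\<^bsub>sym_group n\<^esub> \<tau> = \<rho>} = {p \<in> ?S \<times> ?S. fst p \<circ> snd p = \<rho>}"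
      by (auto simp: sym_group_def)
    then show "group_ring_mult n c d \<rho> * ?f \<rho> =
      (\<Sum>(\<sigma>, \<tau>) \<in> {p \<in> ?S \<times> ?S. fst p \<circ> snd p = \<rho>}. c \<sigma> * d \<tau> * ?f (\<sigma> \<circ> \<tau>))"
      unfolding group_ring_mult_def carrier_sym_group sum_distrib_right
      by (auto intro!: sum.cong)
  qed
  \<comment> \<open>The fibres of composition partition the set of pairs.\<close>
  also have "\<dots> = (\<Sum>(\<sigma>, \<tau>) \<in> ?S \<times> ?S. c \<sigma> * d \<tau> * ?f (\<sigma> \<circ> \<tau>))"
    by (rule sum.group) (use fin in \<open>auto intro: permutes_compose\<close>)
  also have "\<dots> = (\<Sum>\<sigma>\<in>?S. \<Sum>\<tau>\<in>?S. c \<sigma> * d (inv' \<tau>) * ?f (\<sigma> \<circ> inv' \<tau>))"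
    unfolding sum.cartesian_product[symmetric]
    by (rule sum.cong[OF refl], rule sum_permutations_inverse)
  also have "\<dots> = (\<Sum>\<sigma>\<in>?S. \<Sum>\<tau>\<in>?S. c \<sigma> * d (inv' \<tau>) * (\<Prod>k = 1..n. z (\<sigma> k) - w (\<tau> k)))"
  proof (intro sum.cong refl)
    fix \<sigma> \<tau> assume "\<tau> \<in> ?S"
    then have \<tau>: "\<tau> permutes {1..n}" by simp
    have "?f (\<sigma> \<circ> inv' \<tau>) = (\<Prod>k = 1..n. z (\<sigma> k) - w (\<tau> k))"
      using prod.permute[OF \<tau>, of "\<lambda>j. z ((\<sigma> \<circ> inv' \<tau>) j) - w j"]
      by (simp add: o_def permutes_inverses[OF \<tau>])
    then show "c \<sigma> * d (inv' \<tau>) * ?f (\<sigma> \<circ> inv' \<tau>) =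
      c \<sigma> * d (inv' \<tau>) * (\<Prod>k = 1..n. z (\<sigma> k) - w (\<tau> k))" by simp
  qed
  finally show ?thesis by (simp add: sum.cartesian_product)
qed

section \<open>Multiaffinity and conclusion\<close>

lemma multiaffine_perm_poly: "multiaffine n (perm_poly n c)"
  unfolding multiaffine_def
proof (intro exI allI)
  fix z w :: "nat \<Rightarrow> complex"
  let ?S = "{\<sigma>. \<sigma> permutes {1..n}}"
  let ?a = "\<lambda>A B. \<Sum>\<sigma>\<in>?S. if A = \<sigma> ` ({1..n} - B) then c \<sigma> * (- 1) ^ card B else 0"
  have "perm_poly n c z w = (\<Sum>\<sigma>\<in>?S. \<Sum>B\<in>Pow {1..n}.
      c \<sigma> * (- 1) ^ card B * (\<Prod>i\<in>\<sigma> ` ({1..n} - B). z i) * (\<Prod>j\<in>B. w j))"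
    unfolding perm_poly_def carrier_sym_group
  proof (rule sum.cong[OF refl])
    fix \<sigma> assume "\<sigma> \<in> ?S"
    then have "inj \<sigma>" by (simp add: permutes_inj)
    then have inj: "inj_on \<sigma> X" for X by (rule inj_on_subset) simp
    have neg: "(\<Prod>j\<in>B. - w j) = (- 1) ^ card B * (\<Prod>j\<in>B. w j)" for B
      using prod_diff_swap[of "\<lambda>_. 0" w B] by simp
    have "(\<Prod>j = 1..n. z (\<sigma> j) - w j) = (\<Prod>j = 1..n. - w j + z (\<sigma> j))" by simp
    also have "\<dots> = (\<Sum>B\<in>Pow {1..n}. (\<Prod>j\<in>B. - w j) * (\<Prod>j\<in>{1..n} - B. z (\<sigma> j)))"
      by (rule prod_add) simp
    finally show "c \<sigma> * (\<Prod>j = 1..n. z (\<sigma> j) - w j) = (\<Sum>B\<in>Pow {1..n}.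
        c \<sigma> * (- 1) ^ card B * (\<Prod>i\<in>\<sigma> ` ({1..n} - B). z i) * (\<Prod>j\<in>B. w j))"
      by (simp add: neg prod.reindex[OF inj] sum_distrib_left mult_ac)
  qed
  \<comment> \<open>An indicator frees the range of \<open>A\<close> from \<sigma>, so that the sum
    over \<sigma> can be moved inside.\<close>
  also have "\<dots> = (\<Sum>\<sigma>\<in>?S. \<Sum>B\<in>Pow {1..n}. \<Sum>A\<in>Pow {1..n}.
      (if A = \<sigma> ` ({1..n} - B) then c \<sigma> * (- 1) ^ card B else 0) * (\<Prod>i\<in>A. z i) * (\<Prod>j\<in>B. w j))"
  proof (intro sum.cong refl)
    fix \<sigma> B assume "\<sigma> \<in> ?S" "B \<in> Pow {1..n}"
    then have "\<sigma> ` ({1..n} - B) \<in> Pow {1..n}" using permutes_image[of \<sigma> "{1..n}"] by auto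
    then show "c \<sigma> * (- 1) ^ card B * (\<Prod>i\<in>\<sigma> ` ({1..n} - B). z i) * (\<Prod>j\<in>B. w j) =
      (\<Sum>A\<in>Pow {1..n}. (if A = \<sigma> ` ({1..n} - B) then c \<sigma> * (- 1) ^ card B else 0) *
        (\<Prod>i\<in>A. z i) * (\<Prod>j\<in>B. w j))"
      by (simp add: if_distrib[of "\<lambda>x. x * _"] cong: if_cong)
  qed
  also have "\<dots> = (\<Sum>B\<in>Pow {1..n}. \<Sum>A\<in>Pow {1..n}. ?a A B * (\<Prod>i\<in>A. z i) * (\<Prod>j\<in>B. w j))"
    by (subst sum.swap, rule sum.cong[OF refl], subst sum.swap) (simp add: sum_distrib_right)
  also have "\<dots> = (\<Sum>A\<in>Pow {1..n}. \<Sum>B\<in>Pow {1..n}. ?a A B * (\<Prod>i\<in>A. z i) * (\<Prod>j\<in>B. w j))"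
    by (rule sum.swap)
  finally show "perm_poly n c z w =
    (\<Sum>A\<in>Pow {1..n}. \<Sum>B\<in>Pow {1..n}. ?a A B * (\<Prod>i\<in>A. z i) * (\<Prod>j\<in>B. w j))" .
qed

lemma group_ring_mult_closed: "group_ring_mult n c d \<in> group_ring n"
  unfolding group_ring_def group_ring_mult_def
  by (auto simp: sym_group_def permutes_compose intro!: sum.neutral)

theorem mainTheorem4:
  fixes n :: nat and c d :: "(nat \<Rightarrow> nat) \<Rightarrow> complex"
  assumes "n \<ge> 1"
    and "c \<in> {x \<in> group_ring n. grace_like n (perm_poly n x)}"
    and "d \<in> {x \<in> group_ring n. grace_like n (perm_poly n x)}"
  shows "group_ring_mult n c d \<in> {x \<in> group_ring n. grace_like n (perm_poly n x)}"
proof -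
  \<comment> \<open>The coefficients of \<open>d\<close> are inverted to match the right-hand side
    of \<open>perm_poly_mult\<close>.\<close>
  have "nonvanishing n c" "nonvanishing n (\<lambda>\<tau>. d (inv' \<tau>))"
    using assms nonvanishing_inv by (auto simp: grace_like_def nonvanishing_def)
  then have "perm_poly n (group_ring_mult n c d) z w \<noteq> 0" if "separated n z w" for z w
    unfolding perm_poly_mult using contraction_nonzero that by blast
  then show ?thesis by (simp add: grace_like_def multiaffine_perm_poly group_ring_mult_closed)
qed

end
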